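(* Let $p=p(n)\in(0,1)$ be a sequence with $\lim_{n\to\infty}p=0$, and let $P(G(n,p))$ be the probability that a random graph from $G(n,p)$ is connected with diameter at most $2$. Then, as $n\to\infty$, $$P(G(n,p))\geq 1-(1+o(1))\frac{n^2}{2}e^{-np^2}$$ and $$P(G(n,p))\leq(1+o(1))\left(\frac{2}{n^2}e^{np^2}\right)\left(1+4ne^{np^2\left(p^2-1\right)}\right).$$ Suppose further that $$\lim_{n\to\infty}(2\log n-np^2-\log 2)=c$$ for some $c\in\mathbb{R}\setminus\{0\}$. 1) If $c>0$, then $P(G(n,p))\leq(1+o(1))e^{-c}$. 2) If $c<0$, then $P(G(n,p))\geq(1+o(1))(1-e^{c})$.
   Context: $G(n,p)$ denotes the model of simple graphs on $n$ labelled vertices in which each of the $\binom n2$ possible edges is present independently with probability $p$. The diameter of a graph is the maximum over pairs of vertices of their graph distance (infinite if the graph is disconnected). All $o(1)$ terms are as $n\to\infty$. *)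

theory Defs
  imports "HOL-Probability.Probability" "HOL-Library.Landau_Symbols" "Graph_Theory.Graph_Theory"
begin

text \<open>As in \<^theory>\<open>Graph_Theory.Digraph\<close>, a simple undirected graph is a symmetric loop-free
  digraph: an edge \<open>{u, v}\<close> is represented by the two arcs \<open>(u, v)\<close> and \<open>(v, u)\<close>.\<close>

definition possible_edges :: "nat \<Rightarrow> nat set set" where
  "possible_edges n = {e. e \<subseteq> {..<n} \<and> card e = 2}"

definition graph_of_edges :: "nat \<Rightarrow> nat set set \<Rightarrow> nat pair_pre_digraph" where
  "graph_of_edges n E = \<lparr>pverts = {..<n}, parcs = {(u, v). {u, v} \<in> E}\<rparr>"

lemma pair_graph_graph_of_edges:
  assumes "E \<subseteq> possible_edges n"
  shows "pair_graph (graph_of_edges n E)"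
proof
  let ?G = "graph_of_edges n E"
  have edge: "u < n \<and> v < n \<and> u \<noteq> v" if "{u, v} \<in> E" for u v
    using that assms by (force simp: possible_edges_def card_2_iff doubleton_eq_iff)
  have "parcs ?G \<subseteq> {..<n} \<times> {..<n}"
    using edge by (auto simp: graph_of_edges_def)
  then show "finite (parcs ?G)"
    by (rule finite_subset) simp
  show "finite (pverts ?G)" by (simp add: graph_of_edges_def)
  show "symmetric (with_proj ?G)"
    by (auto simp: symmetric_def sym_def graph_of_edges_def insert_commute)
  show "fst e \<in> pverts ?G" "snd e \<in> pverts ?G" "fst e \<noteq> snd e" if "e \<in> parcs ?G" for e
    using that edge[of "fst e" "snd e"] by (auto simp: graph_of_edges_def)
qed

definition gnp :: "nat \<Rightarrow> real \<Rightarrow> nat pair_pre_digraph pmf" where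
  "gnp n p = map_pmf (\<lambda>present. graph_of_edges n {e \<in> possible_edges n. present e})
     (Pi_pmf (possible_edges n) False (\<lambda>_. bernoulli_pmf p))"

text \<open>With unit arc weights, \<^const>\<open>wf_digraph.\<mu>\<close> is the least number of edges of a walk,
  and \<open>\<infinity>\<close> if there is no walk.\<close>

definition graph_dist :: "'a pair_pre_digraph \<Rightarrow> 'a \<Rightarrow> 'a \<Rightarrow> ereal" where
  "graph_dist G u v = wf_digraph.\<mu> (with_proj G) (\<lambda>_. 1) u v"

definition graph_diameter :: "'a pair_pre_digraph \<Rightarrow> ereal" where
  "graph_diameter G = (SUP (u, v) \<in> pverts G \<times> pverts G. graph_dist G u v)"

text \<open>The qualifier avoids the topological notion of connectedness.\<close>

definition prob_diam_le_2 :: "nat \<Rightarrow> real \<Rightarrow> real" where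
  "prob_diam_le_2 n p = measure_pmf.prob (gnp n p)
     {G. Digraph_Component.connected (with_proj G) \<and> graph_diameter G \<le> 2}"

end

(* Call a pair of vertices uncovered if it is neither adjacent nor has a common neighbour; for n > 0
   the graph is connected with diameter at most 2 iff no pair is uncovered. A pair is uncovered with
   probability q = (1 - p) (1 - p^2)^(n - 2), so the union bound gives the lower bound. The upper
   bound is Chebyshev's inequality for the number X of uncovered pairs. With N = n choose 2,
   the pairs of pairs contribute to E X^2 / (E X)^2 - 1 as follows: equal pairs 1 / (N q), pairs
   sharing one vertex about 4 / n, and disjoint pairs O(p^3). The last two together are below
   8 / n, and hence below the product of the two correction terms of the claimed bound, provided
   that p <= sqrt (3 log n / n); for larger p the claimed bound exceeds 1. *)

theory Submission
  imports Defs "HOL-Real_Asymp.Real_Asymp"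
begin

section \<open>Uncovered pairs and the diameter\<close>

lemma possible_edges_iff:
  "e \<in> possible_edges n \<longleftrightarrow> (\<exists>u v. e = {u, v} \<and> u < n \<and> v < n \<and> u \<noteq> v)"
  by (auto simp: possible_edges_def card_2_iff)

text \<open>The pair is kept as a two-element set, so that it is counted once and ranges over the
  same index set as the edges.\<close>

definition uncovered :: "nat \<Rightarrow> nat set set \<Rightarrow> nat set \<Rightarrow> bool" where
  "uncovered n E e \<longleftrightarrow> e \<notin> E \<and> (\<forall>x\<in>{..<n} - e. \<exists>y\<in>e. {x, y} \<notin> E)"

text \<open>With unit weights the cost of a walk is its length, so the distance is governed by walks
  with at most two arcs; \<open>u \<noteq> v\<close> rules out the empty walk.\<close>

lemma pair_wf_digraph_graph_dist_le_2_iff: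
  assumes "pair_wf_digraph G" "u \<in> pverts G" "u \<noteq> v"
  shows "graph_dist G u v \<le> 2 \<longleftrightarrow>
     (u, v) \<in> parcs G \<or> (\<exists>x. (u, x) \<in> parcs G \<and> (x, v) \<in> parcs G)"
proof -
  interpret pair_wf_digraph G by fact
  have cost: "awalk_cost (\<lambda>_. 1) q = real (length q)" for q
    by (induction q) auto
  have verts: "a \<in> pverts G \<and> b \<in> pverts G" if "(a, b) \<in> parcs G" for a b
    using that in_arcsD1 in_arcsD2 by blast
  show ?thesis
  proof
    assume "graph_dist G u v \<le> 2"
    \<comment> \<open>The infimum yields a witness only from a strict bound. Lengths are integers,
      so relaxing \<open>\<le> 2\<close> to \<open>< 3\<close> loses nothing.\<close>
    then have "(INF q\<in>{q. awalk u q v}. ereal (awalk_cost (\<lambda>_. 1) q)) < ereal 3"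
      unfolding graph_dist_def \<mu>_def by (rule le_less_trans) auto
    then obtain q where q: "awalk u q v" "length q < 3"
      by (auto simp: INF_less_iff cost simp del: numeral_eq_ereal)
    then consider "q = []" | a where "q = [a]" | a b where "q = [a, b]"
      by (cases q; cases "tl q"; cases "tl (tl q)") auto
    then show "(u, v) \<in> parcs G \<or> (\<exists>x. (u, x) \<in> parcs G \<and> (x, v) \<in> parcs G)"
    proof cases
      case 3
      then show ?thesis using q \<open>u \<noteq> v\<close> by (cases a; cases b) (auto simp: awalk_simps)
    qed (use q \<open>u \<noteq> v\<close> in \<open>auto simp: awalk_simps\<close>)
  next
    assume "(u, v) \<in> parcs G \<or> (\<exists>x. (u, x) \<in> parcs G \<and> (x, v) \<in> parcs G)"
    then obtain q where q: "awalk u q v" "length q \<le> 2"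
    proof (elim disjE exE conjE)
      assume "(u, v) \<in> parcs G"
      then show ?thesis using that[of "[(u, v)]"] verts by (auto simp: awalk_simps)
    next
      fix x assume "(u, x) \<in> parcs G" "(x, v) \<in> parcs G"
      then show ?thesis using that[of "[(u, x), (x, v)]"] verts by (auto simp: awalk_simps)
    qed
    have "graph_dist G u v \<le> ereal (real (length q))"
      using min_cost_le_walk_cost[OF q(1), of "\<lambda>_. 1"] by (simp add: graph_dist_def cost)
    also have "\<dots> \<le> 2" using q(2) by simp
    finally show "graph_dist G u v \<le> 2" .
  qed
qed

text \<open>Finite distance already means reachability, so the diameter bound implies connectedness
  once there is a vertex: \<open>connected\<close> demands a nonempty vertex set, hence
  \<open>n > 0\<close>.\<close>

lemma connected_diameter_le_2_iff:
  assumes "E \<subseteq> possible_edges n" "n > 0"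
  defines "G \<equiv> graph_of_edges n E"
  shows "Digraph_Component.connected (with_proj G) \<and> graph_diameter G \<le> 2 \<longleftrightarrow>
     (\<forall>e\<in>possible_edges n. \<not> uncovered n E e)"
proof -
  interpret pair_graph G unfolding G_def by (rule pair_graph_graph_of_edges) fact
  have pv: "pverts G = {..<n}" and pa: "(a, b) \<in> parcs G \<longleftrightarrow> {a, b} \<in> E" for a b
    by (simp_all add: G_def graph_of_edges_def)
  have edge: "a < n \<and> b < n \<and> a \<noteq> b" if "{a, b} \<in> E" for a b
    using that assms by (force simp: possible_edges_def card_2_iff doubleton_eq_iff)
  have self: "graph_dist G u u \<le> 2" if "u < n" for u
    using min_cost_le_walk_cost[of u "[]" u "\<lambda>_. 1"] that pv
    by (auto simp: graph_dist_def awalk_simps intro: order_trans)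
  have dist: "graph_dist G u v \<le> 2 \<longleftrightarrow> \<not> uncovered n E {u, v}" if "u < n" "v < n" "u \<noteq> v" for u v
    using that edge pair_wf_digraph_graph_dist_le_2_iff[of G u v]
    by (fastforce simp: pv pa uncovered_def insert_commute pair_wf_digraph_axioms)
  have diam: "graph_diameter G \<le> 2 \<longleftrightarrow> (\<forall>u<n. \<forall>v<n. u \<noteq> v \<longrightarrow> \<not> uncovered n E {u, v})"
    unfolding graph_diameter_def SUP_le_iff using self dist by (auto simp: pv) metis
  have conn: "Digraph_Component.connected (with_proj G)" if "graph_diameter G \<le> 2"
  proof -
    have "u \<rightarrow>\<^sup>*\<^bsub>with_proj G\<^esub> v" if "u < n" "v < n" for u v
    proof -
      have "graph_dist G u v \<le> 2" using self dist diam that \<open>graph_diameter G \<le> 2\<close> by metis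
      then have "graph_dist G u v < \<infinity>" by (rule le_less_trans) simp
      then show ?thesis by (simp only: graph_dist_def \<mu>_reach_conv)
    qed
    then show ?thesis
      using \<open>n > 0\<close> unfolding Digraph_Component.connected_def
      by (intro strongly_connectedI) (auto simp: pv intro: reachable_mk_symmetricI)
  qed
  have "Digraph_Component.connected (with_proj G) \<and> graph_diameter G \<le> 2 \<longleftrightarrow> graph_diameter G \<le> 2"
    by (intro iffI conjI conn) (erule conjunct2)
  also note diam
  also have "(\<forall>u<n. \<forall>v<n. u \<noteq> v \<longrightarrow> \<not> uncovered n E {u, v}) \<longleftrightarrow>
      (\<forall>e\<in>possible_edges n. \<not> uncovered n E e)"
    unfolding Ball_def possible_edges_iff by blast
  finally show ?thesis .
qed

section \<open>Joint probabilities\<close>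

text \<open>The event is a box, confined to \<open>False\<close> on \<open>C\<close> and free
  elsewhere, so its measure factorises.\<close>

lemma Pi_pmf_bernoulli_absent:
  assumes "finite A" "C \<subseteq> A" "0 \<le> p" "p \<le> 1"
  shows "measure_pmf.prob (Pi_pmf A False (\<lambda>_. bernoulli_pmf p)) {f. \<forall>e\<in>C. \<not> f e}
    = (1 - p) ^ card C"
proof -
  have "measure_pmf.prob (Pi_pmf A False (\<lambda>_. bernoulli_pmf p)) {f. \<forall>e\<in>C. \<not> f e}
     = measure_pmf.prob (Pi_pmf A False (\<lambda>_. bernoulli_pmf p))
         (Pi A (\<lambda>e. if e \<in> C then {False} else UNIV))"
    using assms(2) by (intro arg_cong[where f = "measure_pmf.prob _"]) (auto simp: Pi_def)
  also have "\<dots> = (\<Prod>e\<in>A. if e \<in> C then 1 - p else 1)"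
    using assms by (subst measure_Pi_pmf_Pi)
      (auto intro!: prod.cong simp: measure_pmf_single simp flip: UNIV_bool)
  also have "\<dots> = (1 - p) ^ card C"
    using assms by (simp add: prod.If_cases Int_absorb1)
  finally show ?thesis .
qed

text \<open>Independence of the blocks is hidden in the generalisation over \<open>C\<close>: removing a block
  by inclusion-exclusion only enlarges the set of coordinates that have to be absent.\<close>

lemma Pi_pmf_bernoulli_absent_blocks:
  assumes "finite A" "0 \<le> p" "p \<le> 1" "finite J"
    and "C \<subseteq> A" "\<And>j. j \<in> J \<Longrightarrow> F j \<union> G j \<subseteq> A" "\<And>j. j \<in> J \<Longrightarrow> C \<inter> (F j \<union> G j) = {}"
    and "\<And>i j. i \<in> J \<Longrightarrow> j \<in> J \<Longrightarrow> i \<noteq> j \<Longrightarrow> (F i \<union> G i) \<inter> (F j \<union> G j) = {}"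
  shows "measure_pmf.prob (Pi_pmf A False (\<lambda>_. bernoulli_pmf p))
      {f. (\<forall>e\<in>C. \<not> f e) \<and> (\<forall>j\<in>J. (\<forall>e\<in>F j. \<not> f e) \<or> (\<forall>e\<in>G j. \<not> f e))}
    = (1 - p) ^ card C *
      (\<Prod>j\<in>J. (1 - p) ^ card (F j) + (1 - p) ^ card (G j) - (1 - p) ^ card (F j \<union> G j))"
  using assms(4-)
proof (induction J arbitrary: C rule: finite_induct)
  case empty
  then show ?case using assms by (simp add: Pi_pmf_bernoulli_absent)
next
  case (insert k J)
  let ?P = "measure_pmf.prob (Pi_pmf A False (\<lambda>_. bernoulli_pmf p))"
  let ?R = "\<Prod>j\<in>J. (1 - p) ^ card (F j) + (1 - p) ^ card (G j) - (1 - p) ^ card (F j \<union> G j)"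
  \<comment> \<open>\<open>S D\<close> is the event for \<open>J\<close> with \<open>C\<close>
    enlarged by \<open>D\<close>. It is evaluated for \<open>D\<close> equal to \<open>F k\<close>,
    \<open>G k\<close> and their union, the three terms of inclusion-exclusion.\<close>
  define S where "S D = {f. (\<forall>e\<in>C \<union> D. \<not> f e) \<and>
    (\<forall>j\<in>J. (\<forall>e\<in>F j. \<not> f e) \<or> (\<forall>e\<in>G j. \<not> f e))}" for D
  have S: "?P (S D) = (1 - p) ^ card C * (1 - p) ^ card D * ?R" if "D \<subseteq> F k \<union> G k" for D
  proof -
    have fin: "finite C" "finite D" and disj: "C \<inter> D = {}"
      using \<open>finite A\<close> insert.prems(1) insert.prems(2,3)[of k] that
      by (auto intro: finite_subset)
    have "?P (S D) = (1 - p) ^ card (C \<union> D) * ?R"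
      unfolding S_def
    proof (rule insert.IH)
      show "C \<union> D \<subseteq> A" using insert.prems(1,2) that by blast
      show "F j \<union> G j \<subseteq> A" if "j \<in> J" for j using insert.prems(2) that by blast
      show "(C \<union> D) \<inter> (F j \<union> G j) = {}" if "j \<in> J" for j
        using insert.prems(3)[of j] insert.prems(4)[of k j] insert.hyps that \<open>D \<subseteq> F k \<union> G k\<close>
        by (cases "j = k") auto
      show "(F i \<union> G i) \<inter> (F j \<union> G j) = {}" if "i \<in> J" "j \<in> J" "i \<noteq> j" for i j
        using insert.prems(4) that by blast
    qed
    then show ?thesis using fin disj by (simp add: card_Un_disjoint power_add)
  qed
  have "{f. (\<forall>e\<in>C. \<not> f e) \<and> (\<forall>j\<in>insert k J. (\<forall>e\<in>F j. \<not> f e) \<or> (\<forall>e\<in>G j. \<not> f e))}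
      = S (F k) \<union> S (G k)"
    by (auto simp: S_def)
  moreover have "S (F k) \<inter> S (G k) = S (F k \<union> G k)"
    by (auto simp: S_def)
  moreover have "?P (S (F k) \<union> S (G k)) = ?P (S (F k)) + ?P (S (G k)) - ?P (S (F k) \<inter> S (G k))"
    by (subst measure_Un3) (simp_all add: fmeasurable_def less_top[symmetric])
  ultimately show ?case
    using insert.hyps by (simp add: S algebra_simps)
qed

section \<open>One or two uncovered pairs\<close>

lemma finite_possible_edges [simp]: "finite (possible_edges n)"
  by (rule finite_subset[of _ "Pow {..<n}"]) (auto simp: possible_edges_def)

lemma card_possible_edges: "card (possible_edges n) = n choose 2"
  by (simp add: possible_edges_def n_subsets)

lemma doubleton_in_possible_edges [simp]:
  "{u, v} \<in> possible_edges n \<longleftrightarrow> u < n \<and> v < n \<and> u \<noteq> v"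
  by (auto simp: possible_edges_iff doubleton_eq_iff)

abbreviation edge_pmf :: "nat \<Rightarrow> real \<Rightarrow> (nat set \<Rightarrow> bool) pmf" where
  "edge_pmf n p \<equiv> Pi_pmf (possible_edges n) False (\<lambda>_. bernoulli_pmf p)"

text \<open>Formulated on edge indicators, whose coordinates are independent, rather than on graphs;
  the filter matches the one in \<open>gnp\<close>.\<close>

definition uncovered_event :: "nat \<Rightarrow> nat set \<Rightarrow> (nat set \<Rightarrow> bool) set" where
  "uncovered_event n e = {f. uncovered n {a \<in> possible_edges n. f a} e}"

lemma prob_diam_le_2_eq:
  assumes "n > 0"
  shows "prob_diam_le_2 n p =
    measure_pmf.prob (edge_pmf n p) {f. \<forall>e\<in>possible_edges n. f \<notin> uncovered_event n e}"
proof -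
  let ?g = "\<lambda>f. graph_of_edges n {e \<in> possible_edges n. f e}"
  have "Digraph_Component.connected (with_proj (?g f)) \<and> graph_diameter (?g f) \<le> 2 \<longleftrightarrow>
      (\<forall>e\<in>possible_edges n. f \<notin> uncovered_event n e)" for f
    using assms by (subst connected_diameter_le_2_iff) (auto simp: uncovered_event_def)
  then show ?thesis
    unfolding prob_diam_le_2_def gnp_def measure_map_pmf vimage_Collect_eq by simp
qed

lemma uncovered_event_doubleton:
  assumes "u < n" "v < n" "u \<noteq> v"
  shows "uncovered_event n {u, v} =
    {f. \<not> f {u, v} \<and> (\<forall>x\<in>{..<n} - {u, v}. \<not> f {x, u} \<or> \<not> f {x, v})}"
  using assms by (auto simp: uncovered_event_def uncovered_def)

text \<open>There is one block per third vertex \<open>x\<close>, with the single edges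
  \<open>{x, u}\<close> and \<open>{x, v}\<close> as alternatives; it contributes
  \<open>2 * (1 - p) - (1 - p)^2 = 1 - p^2\<close>.\<close>

lemma prob_uncovered:
  assumes "0 \<le> p" "p \<le> 1" "e \<in> possible_edges n"
  shows "measure_pmf.prob (edge_pmf n p) (uncovered_event n e) = (1 - p) * (1 - p\<^sup>2) ^ (n - 2)"
proof -
  obtain u v where e: "e = {u, v}" "u < n" "v < n" "u \<noteq> v"
    using assms by (auto simp: possible_edges_iff)
  let ?J = "{..<n} - {u, v}"
  have card: "card ?J = n - 2" using e by (simp add: card_Diff_subset)
  have "uncovered_event n e = {f. (\<forall>a\<in>{{u, v}}. \<not> f a) \<and>
      (\<forall>x\<in>?J. (\<forall>a\<in>{{x, u}}. \<not> f a) \<or> (\<forall>a\<in>{{x, v}}. \<not> f a))}"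
    using e by (simp add: uncovered_event_doubleton)
  also have "measure_pmf.prob (edge_pmf n p) \<dots> = (1 - p) ^ card {{u, v}} *
      (\<Prod>x\<in>?J. (1 - p) ^ card {{x, u}} + (1 - p) ^ card {{x, v}}
        - (1 - p) ^ card ({{x, u}} \<union> {{x, v}}))"
    using assms e by (intro Pi_pmf_bernoulli_absent_blocks) (auto simp: doubleton_eq_iff)
  also have "\<dots> = (1 - p) * (\<Prod>x\<in>?J. 1 - p\<^sup>2)"
    using e by (auto intro!: prod.cong simp: doubleton_eq_iff card_insert_if power2_eq_square algebra_simps)
  finally show ?thesis by (simp add: card)
qed

text \<open>At a vertex \<open>x\<close> outside the two pairs both conditions hold iff
  \<open>{x, u}\<close> is absent or both \<open>{x, v}\<close> and \<open>{x, w}\<close> are, which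
  gives the factor \<open>(1 - p) + (1 - p)^2 - (1 - p)^3\<close>. The conditions at
  \<open>v\<close> and \<open>w\<close> follow from the absence of the two pairs themselves.\<close>

lemma prob_uncovered_share:
  assumes "0 \<le> p" "p \<le> 1" "u < n" "v < n" "w < n" "u \<noteq> v" "u \<noteq> w" "v \<noteq> w"
  shows "measure_pmf.prob (edge_pmf n p) (uncovered_event n {u, v} \<inter> uncovered_event n {u, w})
    \<le> (1 - p)\<^sup>2 * (1 - 2 * p\<^sup>2 + p ^ 3) ^ (n - 3)"
proof -
  let ?J = "{..<n} - {u, v, w}"
  have card: "card ?J = n - 3" using assms by (simp add: card_Diff_subset)
  have "uncovered_event n {u, v} \<inter> uncovered_event n {u, w} \<subseteq> {f. (\<forall>a\<in>{{u, v}, {u, w}}. \<not> f a) \<and>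
      (\<forall>x\<in>?J. (\<forall>a\<in>{{x, u}}. \<not> f a) \<or> (\<forall>a\<in>{{x, v}, {x, w}}. \<not> f a))}"
    using assms by (auto simp: uncovered_event_doubleton)
  then have "measure_pmf.prob (edge_pmf n p) (uncovered_event n {u, v} \<inter> uncovered_event n {u, w})
      \<le> measure_pmf.prob (edge_pmf n p) {f. (\<forall>a\<in>{{u, v}, {u, w}}. \<not> f a) \<and>
      (\<forall>x\<in>?J. (\<forall>a\<in>{{x, u}}. \<not> f a) \<or> (\<forall>a\<in>{{x, v}, {x, w}}. \<not> f a))}"
    by (intro measure_pmf.finite_measure_mono) auto
  also have "\<dots> = (1 - p) ^ card {{u, v}, {u, w}} *
      (\<Prod>x\<in>?J. (1 - p) ^ card {{x, u}} + (1 - p) ^ card {{x, v}, {x, w}}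
        - (1 - p) ^ card ({{x, u}} \<union> {{x, v}, {x, w}}))"
    using assms by (intro Pi_pmf_bernoulli_absent_blocks) (auto simp: doubleton_eq_iff)
  also have "\<dots> = (1 - p)\<^sup>2 * (\<Prod>x\<in>?J. 1 - 2 * p\<^sup>2 + p ^ 3)"
    using assms by (auto intro!: prod.cong
      simp: doubleton_eq_iff card_insert_if power2_eq_square power3_eq_cube algebra_simps)
  finally show ?thesis by (simp add: card)
qed

text \<open>Besides the \<open>2 * (n - 4)\<close> cherries with a centre outside the two pairs, the four edges
  between the pairs form a 4-cycle; one of its two perfect matchings has to be absent.\<close>

lemma prob_uncovered_disjoint:
  assumes "0 \<le> p" "p \<le> 1" "u < n" "v < n" "w < n" "x < n" "distinct [u, v, w, x]"
  shows "measure_pmf.prob (edge_pmf n p) (uncovered_event n {u, v} \<inter> uncovered_event n {w, x})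
    \<le> (1 - p)\<^sup>2 * (1 - (2 * p - p\<^sup>2)\<^sup>2) * (1 - p\<^sup>2) ^ (2 * (n - 4))"
proof -
  define K where "K = {..<n} - {u, v, w, x}"
  \<comment> \<open>\<open>(y, True)\<close> and \<open>(y, False)\<close> index the cherries
    centred at \<open>y\<close> over \<open>{u, v}\<close> and over \<open>{w, x}\<close>. Since
    \<open>u \<notin> K\<close>, the index \<open>(u, True)\<close> is free for the 4-cycle, whose
    alternatives are its two perfect matchings.\<close>
  define J where "J = insert (u, True) (K \<times> (UNIV :: bool set))"
  define F where "F = (\<lambda>(y, b). if y = u then {{u, w}, {v, x}} else if b then {{y, u}} else {{y, w}})"
  define G where "G = (\<lambda>(y, b). if y = u then {{u, x}, {v, w}} else if b then {{y, v}} else {{y, x}})"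
  have D: "u \<noteq> v" "u \<noteq> w" "u \<noteq> x" "v \<noteq> w" "v \<noteq> x" "w \<noteq> x" using assms by auto
  have [simp]: "finite K" by (simp add: K_def)
  have card: "card K = n - 4" using assms by (simp add: K_def card_Diff_subset)
  have "uncovered_event n {u, v} \<inter> uncovered_event n {w, x} \<subseteq> {f. (\<forall>a\<in>{{u, v}, {w, x}}. \<not> f a) \<and>
      (\<forall>j\<in>J. (\<forall>a\<in>F j. \<not> f a) \<or> (\<forall>a\<in>G j. \<not> f a))}"
  proof
    fix f assume "f \<in> uncovered_event n {u, v} \<inter> uncovered_event n {w, x}"
    then have f: "\<not> f {u, v}" "\<not> f {w, x}"
      "\<And>y. y < n \<Longrightarrow> y \<noteq> u \<Longrightarrow> y \<noteq> v \<Longrightarrow> \<not> f {y, u} \<or> \<not> f {y, v}"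
      "\<And>y. y < n \<Longrightarrow> y \<noteq> w \<Longrightarrow> y \<noteq> x \<Longrightarrow> \<not> f {y, w} \<or> \<not> f {y, x}"
      using assms by (auto simp: uncovered_event_doubleton)
    \<comment> \<open>No two present edges of the 4-cycle share a vertex, so all of them lie in one
      perfect matching and the other one is absent.\<close>
    have "(\<forall>a\<in>{{u, w}, {v, x}}. \<not> f a) \<or> (\<forall>a\<in>{{u, x}, {v, w}}. \<not> f a)"
      using f(3)[of w] f(3)[of x] f(4)[of u] f(4)[of v] assms by (auto simp: insert_commute)
    with f show "f \<in> {f. (\<forall>a\<in>{{u, v}, {w, x}}. \<not> f a) \<and>
      (\<forall>j\<in>J. (\<forall>a\<in>F j. \<not> f a) \<or> (\<forall>a\<in>G j. \<not> f a))}"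
      by (auto simp: J_def K_def F_def G_def)
  qed
  then have "measure_pmf.prob (edge_pmf n p) (uncovered_event n {u, v} \<inter> uncovered_event n {w, x})
      \<le> measure_pmf.prob (edge_pmf n p) {f. (\<forall>a\<in>{{u, v}, {w, x}}. \<not> f a) \<and>
      (\<forall>j\<in>J. (\<forall>a\<in>F j. \<not> f a) \<or> (\<forall>a\<in>G j. \<not> f a))}"
    by (intro measure_pmf.finite_measure_mono) auto
  also have "\<dots> = (1 - p) ^ card {{u, v}, {w, x}} *
      (\<Prod>j\<in>J. (1 - p) ^ card (F j) + (1 - p) ^ card (G j) - (1 - p) ^ card (F j \<union> G j))"
  proof (rule Pi_pmf_bernoulli_absent_blocks)
    have K: "u \<notin> K" "v \<notin> K" "w \<notin> K" "x \<notin> K" "\<And>z. z \<in> K \<Longrightarrow> z < n"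
      by (auto simp: K_def)
    have block: "(j = (u, True) \<and> F j \<union> G j = {{u, w}, {v, x}, {u, x}, {v, w}}) \<or>
        (\<exists>y\<in>K. j = (y, True) \<and> F j \<union> G j = {{y, u}, {y, v}}) \<or>
        (\<exists>y\<in>K. j = (y, False) \<and> F j \<union> G j = {{y, w}, {y, x}})" if "j \<in> J" for j
    proof (cases j)
      case (Pair y b)
      then show ?thesis using that K(1) by (cases b; cases "y = u") (auto simp: J_def F_def G_def)
    qed
    have "F j \<union> G j \<subseteq> possible_edges n \<and> {{u, v}, {w, x}} \<inter> (F j \<union> G j) = {}" if j: "j \<in> J" for j
      using block[OF j]
    proof (elim disjE conjE bexE)
      assume "F j \<union> G j = {{u, w}, {v, x}, {u, x}, {v, w}}"
      then show ?thesis using D assms(3-6) by (simp add: doubleton_eq_iff)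
    next
      fix y assume "y \<in> K" "F j \<union> G j = {{y, u}, {y, v}}"
      moreover from this have "y < n" "y \<noteq> u" "y \<noteq> v" "y \<noteq> w" "y \<noteq> x" using K by blast+
      ultimately show ?thesis using assms(3-6) by (simp add: doubleton_eq_iff)
    next
      fix y assume "y \<in> K" "F j \<union> G j = {{y, w}, {y, x}}"
      moreover from this have "y < n" "y \<noteq> u" "y \<noteq> v" "y \<noteq> w" "y \<noteq> x" using K by blast+
      ultimately show ?thesis using assms(3-6) by (simp add: doubleton_eq_iff)
    qed
    then show "F j \<union> G j \<subseteq> possible_edges n" "{{u, v}, {w, x}} \<inter> (F j \<union> G j) = {}" if "j \<in> J" for j
      using that by blast+
    \<comment> \<open>Any edge of a block determines its index, which makes the blocks disjoint:
      \<open>fst j\<close> is the only vertex of \<open>K\<close> on the edge (none for the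
      4-cycle), and \<open>snd j\<close> tells whether the edge meets \<open>{u, v}\<close>.\<close>
    have index: "(\<forall>z\<in>K. z \<in> a \<longleftrightarrow> z = fst j) \<and> (snd j \<longleftrightarrow> a \<inter> {u, v} \<noteq> {})"
      if j: "j \<in> J" and a: "a \<in> F j \<union> G j" for a j
      using block[OF j]
    proof (elim disjE conjE bexE)
      assume "j = (u, True)" "F j \<union> G j = {{u, w}, {v, x}, {u, x}, {v, w}}"
      then show ?thesis using a K(1-4) by auto
    next
      fix y assume y: "y \<in> K" "j = (y, True)" "F j \<union> G j = {{y, u}, {y, v}}"
      then have "a = {y, u} \<or> a = {y, v}" using a by blast
      then show ?thesis using y K(1-4) by auto
    next
      fix y assume y: "y \<in> K" "j = (y, False)" "F j \<union> G j = {{y, w}, {y, x}}"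
      then have "a = {y, w} \<or> a = {y, x}" using a by blast
      moreover have "y \<noteq> u" "y \<noteq> v" using y(1) K(1,2) by auto
      ultimately show ?thesis using y K(1-4) D by auto
    qed
    show "(F i \<union> G i) \<inter> (F j \<union> G j) = {}" if "i \<in> J" "j \<in> J" "i \<noteq> j" for i j
    proof (rule ccontr)
      assume "(F i \<union> G i) \<inter> (F j \<union> G j) \<noteq> {}"
      then obtain a where a: "a \<in> F i \<union> G i" "a \<in> F j \<union> G j" by blast
      note I = conjunct1[OF index[OF \<open>i \<in> J\<close> a(1)]] conjunct1[OF index[OF \<open>j \<in> J\<close> a(2)]]
      have "fst i = fst j" if "fst i \<in> K"
        using bspec[OF I(1) that] bspec[OF I(2) that] by simp
      moreover have "fst j = fst i" if "fst j \<in> K"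
        using bspec[OF I(1) that] bspec[OF I(2) that] by simp
      moreover have "fst i = u \<or> fst i \<in> K" "fst j = u \<or> fst j \<in> K"
        using \<open>i \<in> J\<close> \<open>j \<in> J\<close> by (auto simp: J_def)
      ultimately have "fst i = fst j" by metis
      moreover have "snd i = snd j"
        by (rule trans[OF conjunct2[OF index[OF \<open>i \<in> J\<close> a(1)]]
            sym[OF conjunct2[OF index[OF \<open>j \<in> J\<close> a(2)]]]])
      ultimately show False using \<open>i \<noteq> j\<close> by (simp add: prod_eq_iff)
    qed
  qed (use assms in \<open>auto simp: J_def\<close>)
  also have "\<dots> = (1 - p)\<^sup>2 * ((1 - (2 * p - p\<^sup>2)\<^sup>2) * (\<Prod>j\<in>K \<times> (UNIV :: bool set). 1 - p\<^sup>2))"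
  proof -
    have "(\<Prod>j\<in>K \<times> (UNIV :: bool set). (1 - p) ^ card (F j) + (1 - p) ^ card (G j) - (1 - p) ^ card (F j \<union> G j))
        = (\<Prod>j\<in>K \<times> (UNIV :: bool set). 1 - p\<^sup>2)"
    proof (rule prod.cong)
      fix j assume "j \<in> K \<times> (UNIV :: bool set)"
      then obtain y b where j: "j = (y, b)" "y \<noteq> u" "y \<noteq> v" "y \<noteq> w" "y \<noteq> x"
        by (auto simp: K_def)
      then have "card (F j) = 1" "card (G j) = 1" "card (F j \<union> G j) = 2"
        using D by (cases b; simp add: F_def G_def doubleton_eq_iff)+
      then show "(1 - p) ^ card (F j) + (1 - p) ^ card (G j) - (1 - p) ^ card (F j \<union> G j) = 1 - p\<^sup>2"
        by (simp add: power2_eq_square algebra_simps)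
    qed simp
    moreover have "card (F (u, True)) = 2" "card (G (u, True)) = 2"
      "card (F (u, True) \<union> G (u, True)) = 4" "card {{u, v}, {w, x}} = 2"
      using assms by (auto simp: F_def G_def doubleton_eq_iff card_insert_if)
    moreover have "(u, True) \<notin> K \<times> (UNIV :: bool set)" by (simp add: K_def)
    \<comment> \<open>A matching has a present edge with probability
      \<open>1 - (1 - p)^2 = 2 * p - p^2\<close>; the block fails only if both matchings do.\<close>
    moreover have "(1 - p)\<^sup>2 + (1 - p)\<^sup>2 - (1 - p) ^ 4 = 1 - (2 * p - p\<^sup>2)\<^sup>2"
      by (simp add: power2_eq_square power4_eq_xxxx algebra_simps)
    ultimately show ?thesis by (simp add: J_def)
  qed
  finally show ?thesis by (simp add: card card_cartesian_product mult_ac)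
qed

section \<open>Second moment method and union bound\<close>

text \<open>Chebyshev's inequality at zero: \<open>\<mu>^2\<close> times the indicator of
  \<open>X = 0\<close> is at most \<open>(X - \<mu>)^2\<close> pointwise, and the latter has
  expectation \<open>E X^2 - \<mu>^2\<close>.\<close>

lemma (in prob_space) prob_none_le_second_moment:
  assumes "finite I" "I \<noteq> {}" "q > 0"
    and "\<And>i. i \<in> I \<Longrightarrow> B i \<in> events" "\<And>i. i \<in> I \<Longrightarrow> prob (B i) = q"
  shows "prob {x \<in> space M. \<forall>i\<in>I. x \<notin> B i}
    \<le> (\<Sum>i\<in>I. \<Sum>j\<in>I. prob (B i \<inter> B j)) / (real (card I) * q)\<^sup>2 - 1"
proof -
  define \<mu> where "\<mu> = real (card I) * q"
  define X where "X = (\<lambda>x. \<Sum>i\<in>I. indicator (B i) x :: real)"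
  define S where "S = (\<Sum>i\<in>I. \<Sum>j\<in>I. prob (B i \<inter> B j))"
  have "\<mu> > 0" using assms by (simp add: \<mu>_def card_gt_0_iff)
  note [measurable] = assms(4)
  have BB: "B i \<inter> B j \<in> events" if "i \<in> I" "j \<in> I" for i j using assms that by blast
  have int: "integrable M (\<lambda>x. indicator (A) x :: real)" if "A \<in> events" for A
    using that by (simp add: integrable_indicator_iff less_top[symmetric])
  have X2: "(X x)\<^sup>2 = (\<Sum>i\<in>I. \<Sum>j\<in>I. indicator (B i \<inter> B j) x)" for x
    unfolding X_def power2_eq_square sum_product by (simp add: indicator_inter_arith)
  have iX: "integrable M X"
    unfolding X_def by (intro Bochner_Integration.integrable_sum int assms)
  have iX2: "integrable M (\<lambda>x. (X x)\<^sup>2)"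
    unfolding X2 by (intro Bochner_Integration.integrable_sum int BB)
  have "expectation X = (\<Sum>i\<in>I. prob (B i))"
    unfolding X_def by (subst Bochner_Integration.integral_sum) (simp_all add: int assms(4))
  then have EX: "expectation X = \<mu>" by (simp add: \<mu>_def assms(5))
  have "expectation (\<lambda>x. (X x)\<^sup>2) = (\<Sum>i\<in>I. expectation (\<lambda>x. \<Sum>j\<in>I. indicator (B i \<inter> B j) x))"
    unfolding X2
    by (intro Bochner_Integration.integral_sum Bochner_Integration.integrable_sum int BB)
  also have "\<dots> = (\<Sum>i\<in>I. \<Sum>j\<in>I. expectation (indicator (B i \<inter> B j)))"
    by (intro sum.cong refl Bochner_Integration.integral_sum int BB)
  also have "\<dots> = S"
    unfolding S_def by (intro sum.cong refl) (simp add: BB)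
  finally have EX2: "expectation (\<lambda>x. (X x)\<^sup>2) = S" .
  let ?N = "{x \<in> space M. \<forall>i\<in>I. x \<notin> B i}"
  have N: "?N \<in> events" using assms by measurable
  have "\<mu>\<^sup>2 * prob ?N = expectation (\<lambda>x. \<mu>\<^sup>2 * indicator ?N x)"
    using N by simp
  also have "\<dots> \<le> expectation (\<lambda>x. (X x)\<^sup>2 - 2 * \<mu> * X x + \<mu>\<^sup>2)"
  proof (rule integral_mono)
    show "integrable M (\<lambda>x. \<mu>\<^sup>2 * indicator ?N x)" using int[OF N] by simp
    show "integrable M (\<lambda>x. (X x)\<^sup>2 - 2 * \<mu> * X x + \<mu>\<^sup>2)" using iX iX2 by simp
    show "\<mu>\<^sup>2 * indicator ?N x \<le> (X x)\<^sup>2 - 2 * \<mu> * X x + \<mu>\<^sup>2" if "x \<in> space M" for x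
    proof (cases "x \<in> ?N")
      case True
      then have "X x = 0" by (simp add: X_def)
      then show ?thesis using True by simp
    next
      case False
      have "(X x)\<^sup>2 - 2 * \<mu> * X x + \<mu>\<^sup>2 = (X x - \<mu>)\<^sup>2" by (simp add: power2_eq_square algebra_simps)
      then show ?thesis using False by simp
    qed
  qed
  also have "\<dots> = S - \<mu>\<^sup>2"
    using iX iX2 by (simp add: EX EX2 prob_space) (simp add: power2_eq_square)
  finally have "prob ?N \<le> (S - \<mu>\<^sup>2) / \<mu>\<^sup>2"
    using \<open>\<mu> > 0\<close> by (simp add: field_simps)
  also have "\<dots> = S / \<mu>\<^sup>2 - 1" using \<open>\<mu> > 0\<close> by (simp add: field_simps)
  finally show ?thesis by (simp add: S_def \<mu>_def)
qed

lemma prob_diam_le_2_ge: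
  assumes "0 \<le> p" "p \<le> 1" "n > 0"
  shows "prob_diam_le_2 n p \<ge> 1 - real (n choose 2) * ((1 - p) * (1 - p\<^sup>2) ^ (n - 2))"
proof -
  let ?P = "measure_pmf.prob (edge_pmf n p)"
  have "?P (\<Union>e\<in>possible_edges n. uncovered_event n e)
      \<le> (\<Sum>e\<in>possible_edges n. ?P (uncovered_event n e))"
    by (rule measure_pmf.finite_measure_subadditive_finite) auto
  also have "\<dots> = real (n choose 2) * ((1 - p) * (1 - p\<^sup>2) ^ (n - 2))"
    using assms by (simp add: prob_uncovered card_possible_edges)
  finally have "?P (\<Union>e\<in>possible_edges n. uncovered_event n e)
    \<le> real (n choose 2) * ((1 - p) * (1 - p\<^sup>2) ^ (n - 2))" .
  moreover have "prob_diam_le_2 n p = 1 - ?P (\<Union>e\<in>possible_edges n. uncovered_event n e)"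
    unfolding prob_diam_le_2_eq[OF \<open>n > 0\<close>]
    by (subst measure_pmf.prob_compl[symmetric]) (auto intro!: arg_cong[where f = ?P])
  ultimately show ?thesis by simp
qed

lemma sum_Un_le:
  fixes f :: "'a \<Rightarrow> real"
  assumes "finite A" "finite B" "\<And>x. 0 \<le> f x"
  shows "sum f (A \<union> B) \<le> sum f A + sum f B"
  using assms by (simp add: sum_Un sum_nonneg)

text \<open>The double sum is split into the diagonal \<open>D\<close>, the pairs \<open>T\<close>
  sharing one vertex, and the disjoint pairs. Their numbers are bounded by \<open>N\<close>,
  \<open>n^3\<close> and \<open>N^2\<close>; the joint probabilities by \<open>q\<close>,
  \<open>s\<close> and \<open>d\<close>.\<close>

lemma prob_diam_le_2_le:
  fixes n :: nat and p :: real
  defines "N \<equiv> real (n choose 2)" and "q \<equiv> (1 - p) * (1 - p\<^sup>2) ^ (n - 2)"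
  defines "s \<equiv> (1 - p)\<^sup>2 * (1 - 2 * p\<^sup>2 + p ^ 3) ^ (n - 3)"
  defines "d \<equiv> (1 - p)\<^sup>2 * (1 - (2 * p - p\<^sup>2)\<^sup>2) * (1 - p\<^sup>2) ^ (2 * (n - 4))"
  assumes p: "0 < p" "p < 1" and "n \<ge> 2"
  shows "prob_diam_le_2 n p \<le> (N * q + real n ^ 3 * s + N\<^sup>2 * d) / (N * q)\<^sup>2 - 1"
proof -
  let ?P = "measure_pmf.prob (edge_pmf n p)" and ?I = "possible_edges n"
  let ?U = "\<lambda>(e, e'). uncovered_event n e \<inter> uncovered_event n e'"
  have "p\<^sup>2 < 1" using p by (simp add: power_less_one_iff)
  then have "q > 0" using p by (simp add: q_def)
  \<comment> \<open>Either the edge to the shared vertex is absent, or it is present and the two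
    others are absent. The resulting \<open>s \<ge> 0\<close> permits replacing the size of
    \<open>T\<close> by \<open>n^3\<close>.\<close>
  have "1 - 2 * p\<^sup>2 + p ^ 3 = (1 - p) + p * (1 - p)\<^sup>2"
    by (simp add: power2_eq_square power3_eq_cube algebra_simps)
  moreover have "(1 - p) + p * (1 - p)\<^sup>2 \<ge> 0" using p by simp
  ultimately have "s \<ge> 0" by (simp add: s_def)
  have "1 - (2 * p - p\<^sup>2)\<^sup>2 = (1 - p)\<^sup>2 * (2 - (1 - p)\<^sup>2)"
    by (simp add: power2_eq_square algebra_simps)
  moreover have "(1 - p)\<^sup>2 \<le> 1" using p by (simp add: power_le_one)
  ultimately have "d \<ge> 0" using p \<open>p\<^sup>2 < 1\<close> by (simp add: d_def)
  define D where "D = (\<lambda>e. (e, e)) ` ?I"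
  \<comment> \<open>The shared vertex comes first in the parametrisation, so ordered triples of
    vertices suffice for the count.\<close>
  define T where "T = {({a, b}, {a, c}) |a b c. a < n \<and> b < n \<and> c < n \<and> distinct [a, b, c]}"
  have T: "T \<subseteq> (\<lambda>(a, b, c). ({a, b}, {a, c})) ` ({..<n} \<times> {..<n} \<times> {..<n})"
    by (force simp: T_def)
  have "finite T" using T by (rule finite_subset) auto
  have "card T \<le> card ((\<lambda>(a, b, c). ({a, b}, {a, c})) ` ({..<n} \<times> {..<n} \<times> {..<n}))"
    using T by (rule card_mono[rotated]) auto
  also have "\<dots> \<le> card ({..<n} \<times> {..<n} \<times> {..<n})" by (rule card_image_le) auto
  also have "\<dots> = n ^ 3" by (simp add: power3_eq_cube)
  finally have "real (card T) \<le> real (n ^ 3)" by (rule of_nat_mono)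
  then have cardT: "real (card T) \<le> real n ^ 3" by simp
  have other: "?P (?U z) \<le> d" if z: "z \<in> ?I \<times> ?I - D - T" for z
  proof -
    obtain u v w x where uv: "z = ({u, v}, {w, x})" "u < n" "v < n" "w < n" "x < n" "u \<noteq> v" "w \<noteq> x"
      using z by (auto simp: possible_edges_iff)
    have nt: "({a, b}, {a, c}) \<noteq> z" if "a < n" "b < n" "c < n" "distinct [a, b, c]" for a b c
      using z that unfolding T_def by blast
    have "z \<notin> D" using z by blast
    moreover have "({u, v}, {u, v}) \<in> D"
      unfolding D_def by (rule imageI) (use uv in simp)
    ultimately have ne: "{u, v} \<noteq> {w, x}" using uv(1) by metis
    \<comment> \<open>Each of the four possible coincidences would put \<open>z\<close> into
      \<open>T\<close> with the common vertex as \<open>a\<close>; \<open>ne\<close> makes the two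
      remaining vertices distinct.\<close>
    have "u \<noteq> w" using nt[of u v x] uv ne by force
    moreover have "u \<noteq> x" using nt[of u v w] uv ne by (force simp: insert_commute)
    moreover have "v \<noteq> w" using nt[of v u x] uv ne by (force simp: insert_commute)
    moreover have "v \<noteq> x" using nt[of v u w] uv ne by (force simp: insert_commute)
    ultimately have "distinct [u, v, w, x]" using uv by simp
    then show ?thesis
      using prob_uncovered_disjoint[of p u n v w x] uv p by (simp add: d_def)
  qed
  have "(\<Sum>i\<in>?I. \<Sum>j\<in>?I. ?P (uncovered_event n i \<inter> uncovered_event n j)) = (\<Sum>z\<in>?I \<times> ?I. ?P (?U z))"
    by (simp add: sum.cartesian_product case_prod_unfold)
  also have "\<dots> \<le> (\<Sum>z\<in>D \<union> T \<union> (?I \<times> ?I - D - T). ?P (?U z))"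
    using \<open>finite T\<close> by (intro sum_mono2) (auto simp: D_def)
  also have "\<dots> \<le> (\<Sum>z\<in>D. ?P (?U z)) + (\<Sum>z\<in>T. ?P (?U z)) + (\<Sum>z\<in>?I \<times> ?I - D - T. ?P (?U z))"
    using \<open>finite T\<close> by (intro order_trans[OF sum_Un_le] add_mono sum_Un_le) (auto simp: D_def)
  also have "(\<Sum>z\<in>D. ?P (?U z)) = N * q"
    using p by (simp add: D_def sum.reindex inj_on_def prob_uncovered card_possible_edges N_def q_def)
  also have "(\<Sum>z\<in>T. ?P (?U z)) \<le> (\<Sum>z\<in>T. s)"
    using p prob_uncovered_share[of p _ n] by (intro sum_mono) (auto simp: T_def s_def)
  also have "(\<Sum>z\<in>T. s) \<le> real n ^ 3 * s"
    using cardT \<open>s \<ge> 0\<close> by (simp add: mult_right_mono)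
  also have "(\<Sum>z\<in>?I \<times> ?I - D - T. ?P (?U z)) \<le> (\<Sum>z\<in>?I \<times> ?I - D - T. d)"
    by (intro sum_mono other)
  \<comment> \<open>Counting all \<open>N^2\<close> pairs leaves \<open>d / q^2\<close> after
    normalisation, which is close to 1 and cancels against the \<open>- 1\<close>.\<close>
  also have "\<dots> \<le> (\<Sum>z\<in>?I \<times> ?I. d)"
    using \<open>d \<ge> 0\<close> by (intro sum_mono2) auto
  also have "\<dots> = N\<^sup>2 * d"
    by (simp add: N_def card_cartesian_product card_possible_edges power2_eq_square)
  finally have S: "(\<Sum>i\<in>?I. \<Sum>j\<in>?I. ?P (uncovered_event n i \<inter> uncovered_event n j))
      \<le> N * q + real n ^ 3 * s + N\<^sup>2 * d" by simp
  have "{0, 1} \<in> ?I" using \<open>n \<ge> 2\<close> by simp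
  then have "?I \<noteq> {}" by blast
  then have "prob_diam_le_2 n p \<le> 
     (\<Sum>i\<in>?I. \<Sum>j\<in>?I. ?P (uncovered_event n i \<inter> uncovered_event n j)) / (N * q)\<^sup>2 - 1"
    using measure_pmf.prob_none_le_second_moment[of ?I q "uncovered_event n" "edge_pmf n p"]
      p \<open>q > 0\<close> \<open>n \<ge> 2\<close>
    by (simp add: prob_diam_le_2_eq prob_uncovered card_possible_edges N_def q_def)
  also have "\<dots> \<le> (N * q + real n ^ 3 * s + N\<^sup>2 * d) / (N * q)\<^sup>2 - 1"
    using S by (intro diff_right_mono divide_right_mono) auto
  finally show ?thesis .
qed

section \<open>Asymptotics\<close>

lemma smallo_1I:
  fixes \<epsilon> :: "nat \<Rightarrow> real"
  assumes "\<epsilon> \<longlonglongrightarrow> 0"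
  shows "\<epsilon> \<in> o(\<lambda>_. 1)"
  using assms by (intro smalloI_tendsto) auto

text \<open>From \<open>ln (1 - x) \<ge> - x - 2 * x^2\<close>. Applied to \<open>x = p^2\<close>,
  the loss is the factor \<open>exp (- 2 * n * p^4)\<close>.\<close>

lemma one_minus_power_ge_exp:
  fixes x :: real
  assumes "0 \<le> x" "x \<le> 1 / 2"
  shows "(1 - x) ^ n \<ge> exp (- (real n * x) - 2 * real n * x\<^sup>2)"
proof -
  have "- x - 2 * x\<^sup>2 \<le> ln (1 - x)" using assms by (rule ln_one_minus_pos_lower_bound)
  then have "real n * (- x - 2 * x\<^sup>2) \<le> real n * ln (1 - x)" by (rule mult_left_mono) simp
  also have "\<dots> = ln ((1 - x) ^ n)" using assms by (simp add: ln_realpow)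
  finally have "exp (real n * (- x - 2 * x\<^sup>2)) \<le> (1 - x) ^ n"
    using assms by (subst (asm) ln_ge_iff) auto
  then show ?thesis by (simp add: algebra_simps)
qed

lemma one_minus_power_le_exp:
  fixes x :: real
  assumes "x \<le> 1"
  shows "(1 - x) ^ n \<le> exp (- (real n * x))"
proof -
  have "(1 - x) ^ n \<le> exp (- x) ^ n"
    using assms exp_ge_add_one_self[of "- x"] by (intro power_mono) auto
  also have "\<dots> = exp (- (real n * x))" by (simp add: exp_of_nat_mult[symmetric])
  finally show ?thesis .
qed

lemma real_choose_2: "real (n choose 2) = real n * (real n - 1) / 2"
  by (cases n) (simp_all add: choose_two real_of_nat_div algebra_simps)

section \<open>Normalised joint probabilities\<close>

text \<open>Per vertex, \<open>1 - 2 * p^2 + p^3\<close> exceeds \<open>a = (1 - p^2)^2\<close> by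
  at most \<open>p^3\<close>, and \<open>a \<ge> 1 / 4\<close> turns this into a factor
  \<open>1 + 4 * p^3\<close>. The mismatch of \<open>n - 3\<close> and \<open>n - 2\<close> leaves
  one division by \<open>a\<close>.\<close>

lemma share_ratio_le:
  fixes p :: real
  assumes "0 < p" "p \<le> 1 / 2" "n \<ge> 3"
  shows "(1 - 2 * p\<^sup>2 + p ^ 3) ^ (n - 3) / ((1 - p\<^sup>2) ^ (n - 2))\<^sup>2
    \<le> exp (4 * real n * p ^ 3) / (1 - p\<^sup>2)\<^sup>2"
proof -
  define a where "a = (1 - p\<^sup>2)\<^sup>2"
  have "p\<^sup>2 \<le> (1 / 2)\<^sup>2" using assms by (intro power_mono) auto
  then have p2: "p\<^sup>2 \<le> 1 / 2" by (simp add: power2_eq_square)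
  then have "(1 / 2)\<^sup>2 \<le> a" unfolding a_def by (intro power_mono) auto
  then have a: "1 \<le> 4 * a" "a > 0" by (auto simp: power2_eq_square)
  have p3: "p ^ 3 \<ge> 0" using assms by simp
  have "1 - 2 * p\<^sup>2 + p ^ 3 \<le> a + p ^ 3"
    using zero_le_power2[of "p\<^sup>2"]
    by (simp add: a_def power2_eq_square algebra_simps del: zero_le_power2)
  also have "\<dots> \<le> a * (1 + 4 * p ^ 3)"
    using mult_right_mono[OF a(1) p3] by (simp add: algebra_simps)
  also have "\<dots> \<le> a * exp (4 * p ^ 3)"
    using a by (intro mult_left_mono exp_ge_add_one_self) auto
  finally have "1 - 2 * p\<^sup>2 + p ^ 3 \<le> a * exp (4 * p ^ 3)" .
  moreover have "0 \<le> 1 - 2 * p\<^sup>2 + p ^ 3" using p2 p3 by simp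
  ultimately have "(1 - 2 * p\<^sup>2 + p ^ 3) ^ (n - 3) \<le> (a * exp (4 * p ^ 3)) ^ (n - 3)"
    by (rule power_mono)
  also have "\<dots> = a ^ (n - 3) * exp (4 * real (n - 3) * p ^ 3)"
    by (simp add: power_mult_distrib exp_of_nat_mult[symmetric] mult_ac)
  also have "\<dots> \<le> a ^ (n - 3) * exp (4 * real n * p ^ 3)"
    using a p3 by (intro mult_left_mono) (auto intro!: mult_right_mono)
  finally have "(1 - 2 * p\<^sup>2 + p ^ 3) ^ (n - 3) / a ^ (n - 2)
      \<le> a ^ (n - 3) * exp (4 * real n * p ^ 3) / a ^ (n - 2)"
    using a by (intro divide_right_mono) auto
  also have "\<dots> = exp (4 * real n * p ^ 3) / a"
  proof -
    have "n - 2 = Suc (n - 3)" using \<open>n \<ge> 3\<close> by simp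
    then show ?thesis using a by simp
  qed
  finally have "(1 - 2 * p\<^sup>2 + p ^ 3) ^ (n - 3) / a ^ (n - 2) \<le> exp (4 * real n * p ^ 3) / a" .
  then show ?thesis unfolding a_def by (simp add: power_mult[symmetric] mult.commute)
qed

text \<open>Outside the pairs the factors cancel, leaving the 4-cycle factor
  \<open>1 - 4 * p^2 + 4 * p^3 - p^4\<close> against \<open>b^4 \<ge> 1 - 4 * p^2\<close>. The
  quadratic terms agree, so the excess is at most \<open>4 * p^3\<close>;
  \<open>b^4 \<ge> 1 / 16\<close> yields the constant 64.\<close>

lemma disjoint_ratio_le:
  fixes p :: real
  assumes "0 < p" "p \<le> 1 / 2" "n \<ge> 4"
  shows "(1 - (2 * p - p\<^sup>2)\<^sup>2) * (1 - p\<^sup>2) ^ (2 * (n - 4)) / ((1 - p\<^sup>2) ^ (n - 2))\<^sup>2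
    \<le> 1 + 64 * p ^ 3"
proof -
  define b where "b = 1 - p\<^sup>2"
  have "p\<^sup>2 \<le> (1 / 2)\<^sup>2" using assms by (intro power_mono) auto
  then have b: "1 / 2 \<le> b" by (simp add: b_def power2_eq_square)
  then have "(1 / 2) ^ 4 \<le> b ^ 4" by (intro power_mono) auto
  then have b4: "1 \<le> 16 * b ^ 4" "b ^ 4 > 0" by (auto simp: power4_eq_xxxx)
  have p3: "p ^ 3 \<ge> 0" using assms by simp
  have "1 - 4 * p\<^sup>2 \<le> b ^ 4"
    using Bernoulli_inequality[of "- (p\<^sup>2)" 4] b by (simp add: b_def)
  then have "1 - (2 * p - p\<^sup>2)\<^sup>2 \<le> b ^ 4 + 4 * p ^ 3"
    using mult_nonneg_nonneg[OF zero_le_square[of p] zero_le_square[of p]]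
    by (simp add: power2_eq_square power3_eq_cube power4_eq_xxxx algebra_simps del: zero_le_square)
  also have "\<dots> \<le> b ^ 4 * (1 + 64 * p ^ 3)"
    using mult_right_mono[OF b4(1) p3] by (simp add: algebra_simps)
  finally have *: "1 - (2 * p - p\<^sup>2)\<^sup>2 \<le> b ^ 4 * (1 + 64 * p ^ 3)" .
  have "(b ^ (n - 2))\<^sup>2 = b ^ (2 * (n - 4) + 4)"
    using \<open>n \<ge> 4\<close> by (simp add: power_mult[symmetric] algebra_simps)
  then have "(b ^ (n - 2))\<^sup>2 = b ^ 4 * b ^ (2 * (n - 4))"
    by (simp add: power_add)
  then have "(1 - (2 * p - p\<^sup>2)\<^sup>2) * b ^ (2 * (n - 4)) / (b ^ (n - 2))\<^sup>2 = (1 - (2 * p - p\<^sup>2)\<^sup>2) / b ^ 4"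
    using b by simp
  also have "\<dots> \<le> 1 + 64 * p ^ 3" using * b4 by (simp add: divide_le_eq mult.commute)
  finally show ?thesis by (simp add: b_def)
qed

text \<open>The three summands are divided by \<open>(N * q)^2\<close> separately,
  \<open>(1 - p)^2\<close> cancelling in the last two. Disjoint pairs give at most
  \<open>1 + 64 * p^3\<close>, whose 1 absorbs the \<open>- 1\<close>.\<close>

lemma second_moment_ratio_le:
  fixes n :: nat and p :: real
  defines "N \<equiv> real (n choose 2)" and "q \<equiv> (1 - p) * (1 - p\<^sup>2) ^ (n - 2)"
  defines "s \<equiv> (1 - p)\<^sup>2 * (1 - 2 * p\<^sup>2 + p ^ 3) ^ (n - 3)"
  defines "d \<equiv> (1 - p)\<^sup>2 * (1 - (2 * p - p\<^sup>2)\<^sup>2) * (1 - p\<^sup>2) ^ (2 * (n - 4))"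
  assumes p: "0 < p" "p \<le> 1 / 2" and n: "n \<ge> 4"
  shows "(N * q + real n ^ 3 * s + N\<^sup>2 * d) / (N * q)\<^sup>2 - 1
    \<le> real n / (real n - 1) / (1 - p) * exp (2 * real n * p ^ 4) * (2 / (real n)\<^sup>2 * exp (real n * p\<^sup>2))
      + 4 * real n / (real n - 1)\<^sup>2 * (exp (4 * real n * p ^ 3) / (1 - p\<^sup>2)\<^sup>2) + 64 * p ^ 3"
proof -
  define m where "m = real n"
  define r where "r = (1 - p\<^sup>2) ^ (n - 2)"
  have m: "m \<ge> 4" using n by (simp add: m_def)
  have N: "N = m * (m - 1) / 2" by (simp add: N_def m_def real_choose_2)
  have "p\<^sup>2 \<le> (1 / 2)\<^sup>2" using p by (intro power_mono) auto
  then have p2: "p\<^sup>2 \<le> 1 / 2" by (simp add: power2_eq_square)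
  have "exp (- (m * p\<^sup>2) - 2 * m * (p\<^sup>2)\<^sup>2) \<le> (1 - p\<^sup>2) ^ n"
    using one_minus_power_ge_exp[of "p\<^sup>2" n] p2 by (simp add: m_def)
  \<comment> \<open>The exponent drops from \<open>n\<close> to \<open>n - 2\<close>, which only
    enlarges a power of a base below 1.\<close>
  also have "\<dots> \<le> r" unfolding r_def using p2 by (intro power_decreasing) auto
  finally have r_ge: "exp (- (m * p\<^sup>2) - 2 * m * p ^ 4) \<le> r" by simp
  have "r > 0" using p2 by (simp add: r_def)
  have q: "q = (1 - p) * r" by (simp add: q_def r_def)
  have "q > 0" "N > 0" using p \<open>r > 0\<close> m by (simp_all add: q N)
  have "(N * q + m ^ 3 * s + N\<^sup>2 * d) / (N * q)\<^sup>2 = 1 / (N * q) + m ^ 3 * s / (N * q)\<^sup>2 + d / q\<^sup>2"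
    using \<open>q > 0\<close> \<open>N > 0\<close> by (simp add: add_divide_distrib power2_eq_square)
  moreover have "1 / (N * q) \<le> m / (m - 1) / (1 - p) * exp (2 * m * p ^ 4) * (2 / m\<^sup>2 * exp (m * p\<^sup>2))"
  proof -
    have "1 / r \<le> 1 / exp (- (m * p\<^sup>2) - 2 * m * p ^ 4)"
      using r_ge \<open>r > 0\<close> by (intro divide_left_mono) auto
    also have "\<dots> = exp (2 * m * p ^ 4) * exp (m * p\<^sup>2)"
      by (simp add: exp_diff exp_minus field_simps)
    finally have r_le: "1 / r \<le> exp (2 * m * p ^ 4) * exp (m * p\<^sup>2)" .
    have "1 / (N * q) = 1 / (N * (1 - p)) * (1 / r)" by (simp add: q)
    also have "\<dots> \<le> 1 / (N * (1 - p)) * (exp (2 * m * p ^ 4) * exp (m * p\<^sup>2))"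
      using r_le p \<open>N > 0\<close> by (intro mult_left_mono) auto
    also have "1 / (N * (1 - p)) = m / (m - 1) / (1 - p) * (2 / m\<^sup>2)"
      using m p by (simp add: N field_simps power2_eq_square)
    finally show ?thesis by (simp add: mult_ac)
  qed
  moreover have "m ^ 3 * s / (N * q)\<^sup>2 \<le> 4 * m / (m - 1)\<^sup>2 * (exp (4 * m * p ^ 3) / (1 - p\<^sup>2)\<^sup>2)"
  proof -
    have "m ^ 3 / N\<^sup>2 = 4 * m / (m - 1)\<^sup>2"
      using m by (simp add: N power2_eq_square power3_eq_cube)
    moreover have "s / q\<^sup>2 = (1 - 2 * p\<^sup>2 + p ^ 3) ^ (n - 3) / r\<^sup>2"
      using p by (simp add: s_def q power_mult_distrib)
    ultimately have "m ^ 3 * s / (N * q)\<^sup>2 = 4 * m / (m - 1)\<^sup>2 * ((1 - 2 * p\<^sup>2 + p ^ 3) ^ (n - 3) / r\<^sup>2)"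
      by (metis power_mult_distrib times_divide_times_eq)
    also have "\<dots> \<le> 4 * m / (m - 1)\<^sup>2 * (exp (4 * m * p ^ 3) / (1 - p\<^sup>2)\<^sup>2)"
      using share_ratio_le[of p n] p n m by (intro mult_left_mono) (auto simp: r_def m_def)
    finally show ?thesis .
  qed
  moreover have "d / q\<^sup>2 \<le> 1 + 64 * p ^ 3"
  proof -
    have "d / q\<^sup>2 = (1 - (2 * p - p\<^sup>2)\<^sup>2) * (1 - p\<^sup>2) ^ (2 * (n - 4)) / r\<^sup>2"
      using p by (simp add: d_def q power_mult_distrib)
    then show ?thesis using disjoint_ratio_le[of p n] p n by (simp add: r_def)
  qed
  ultimately show ?thesis unfolding m_def[symmetric] by linarith
qed

section \<open>Estimates uniform in the edge probability\<close>

text \<open>Above the cutoff \<open>exp (n * p\<^sup>2) \<ge> n ^ 3\<close>; below it \<open>n * p ^ 3 \<longrightarrow> 0\<close>, so that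
  \<open>(1 - p\<^sup>2) ^ n\<close> is asymptotic to \<open>exp (- n * p\<^sup>2)\<close> uniformly in \<open>p\<close>.\<close>

definition cutoff :: "nat \<Rightarrow> real" where
  "cutoff n = sqrt (3 * ln (real n) / real n)"

text \<open>The factor multiplying the leading term in \<open>second_moment_ratio_le\<close>
  increases with \<open>p\<close>; taking it at the cutoff makes the error depend on
  \<open>n\<close> alone.\<close>

definition upper_err :: "nat \<Rightarrow> real" where
  "upper_err n = real n / (real n - 1) / (1 - cutoff n) * exp (2 * real n * cutoff n ^ 4) - 1"

lemma upper_err_tendsto_0: "upper_err \<longlonglongrightarrow> 0"
  unfolding upper_err_def cutoff_def by real_asymp

lemma eventually_cutoff_le: "\<forall>\<^sub>F n in sequentially. cutoff n \<le> 1 / 2"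
  unfolding cutoff_def by real_asymp

text \<open>The first summand is asymptotic to \<open>4 / n\<close> because
  \<open>n * cutoff^3\<close> tends to 0, and the second is \<open>o(1 / n)\<close> for the same
  reason; 8 leaves room for both.\<close>

lemma eventually_cutoff_error_le:
  "\<forall>\<^sub>F n in sequentially. 4 * real n / (real n - 1)\<^sup>2 *
     (exp (4 * real n * cutoff n ^ 3) / (1 - (cutoff n)\<^sup>2)\<^sup>2) + 64 * cutoff n ^ 3 \<le> 8 / real n"
  unfolding cutoff_def by real_asymp

text \<open>The cutoff satisfies \<open>n * cutoff^2 = 3 * ln n\<close>. In this range the claimed
  upper bound exceeds 1, so it holds trivially.\<close>

lemma above_cutoff:
  assumes "p > cutoff n" "n > 0"
  shows "2 * real n \<le> 2 / (real n)\<^sup>2 * exp (real n * p\<^sup>2)"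
proof -
  have "ln (real n) \<ge> 0" using assms by simp
  then have "0 \<le> cutoff n" by (simp add: cutoff_def)
  then have "(cutoff n)\<^sup>2 \<le> p\<^sup>2" using assms by (intro power_mono) auto
  moreover have "(cutoff n)\<^sup>2 = 3 * ln (real n) / real n"
    using \<open>ln (real n) \<ge> 0\<close> by (simp add: cutoff_def)
  ultimately have "3 * ln (real n) \<le> real n * p\<^sup>2" using assms by (simp add: field_simps)
  then have "exp (3 * ln (real n)) \<le> exp (real n * p\<^sup>2)" by simp
  moreover have "exp (3 * ln (real n)) = real n ^ 3"
    using assms exp_of_nat_mult[of 3 "ln (real n)"] by simp
  ultimately show ?thesis using assms
    by (simp add: field_simps power2_eq_square power3_eq_cube)
qed

text \<open>Every error factor is increasing in \<open>p\<close> and may be evaluated at the cutoff;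
  only the leading \<open>exp (n * p^2)\<close> keeps its \<open>p\<close>.\<close>

lemma below_cutoff:
  assumes p: "0 < p" "p \<le> cutoff n" and c: "cutoff n \<le> 1 / 2" and n: "n \<ge> 4"
  shows "real n / (real n - 1) / (1 - p) * exp (2 * real n * p ^ 4) * (2 / (real n)\<^sup>2 * exp (real n * p\<^sup>2))
      + 4 * real n / (real n - 1)\<^sup>2 * (exp (4 * real n * p ^ 3) / (1 - p\<^sup>2)\<^sup>2) + 64 * p ^ 3
    \<le> (1 + upper_err n) * (2 / (real n)\<^sup>2 * exp (real n * p\<^sup>2))
      + 4 * real n / (real n - 1)\<^sup>2 * (exp (4 * real n * cutoff n ^ 3) / (1 - (cutoff n)\<^sup>2)\<^sup>2)
      + 64 * cutoff n ^ 3"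
proof -
  have mono: "p ^ k \<le> cutoff n ^ k" for k using p by (intro power_mono) auto
  have "(cutoff n)\<^sup>2 \<le> (1 / 2)\<^sup>2" using p c by (intro power_mono) auto
  then have c2: "(cutoff n)\<^sup>2 < 1" by (simp add: power2_eq_square)
  have "real n / (real n - 1) / (1 - p) * exp (2 * real n * p ^ 4) \<le> 1 + upper_err n"
    unfolding upper_err_def using mono[of 4] p c n
    by (simp only: diff_add_cancel add_diff_cancel_left' add.commute[of 1 "_ - 1"])
       (intro mult_mono divide_left_mono; simp)
  moreover have "exp (4 * real n * p ^ 3) / (1 - p\<^sup>2)\<^sup>2
      \<le> exp (4 * real n * cutoff n ^ 3) / (1 - (cutoff n)\<^sup>2)\<^sup>2"
    using mono[of 2] mono[of 3] c2 
    by (intro frac_le power_mono) (auto intro!: mult_left_mono)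
  ultimately show ?thesis using mono[of 3]
    by (intro add_mono mult_right_mono mult_left_mono) auto
qed

text \<open>The quantifier over \<open>p\<close> stands inside the eventuality: one threshold for
  \<open>n\<close> serves all \<open>p\<close>, so any sequence may be substituted.\<close>

lemma eventually_prob_diam_le_2_le:
  "\<forall>\<^sub>F n in sequentially. \<forall>p\<in>{0<..<1}. prob_diam_le_2 n p
     \<le> (1 + upper_err n) * (2 / (real n)\<^sup>2 * exp (real n * p\<^sup>2))
        * (1 + 4 * real n * exp (real n * p\<^sup>2 * (p\<^sup>2 - 1)))"
  using eventually_cutoff_le eventually_cutoff_error_le eventually_ge_at_top[of "4::nat"]
proof eventually_elim
  case (elim n)
  have "cutoff n \<ge> 0" using elim by (simp add: cutoff_def)
  \<comment> \<open>All three factors are at least 1. Nonnegativity of the error is used on both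
    sides of the cutoff.\<close>
  then have "1 * 1 * exp 0 \<le> real n / (real n - 1) * (1 / (1 - cutoff n)) * exp (2 * real n * cutoff n ^ 4)"
    using elim by (intro mult_mono) auto
  then have err: "0 \<le> upper_err n" by (simp add: upper_err_def)
  show ?case
  proof
    fix p :: real assume p: "p \<in> {0<..<1}"
    define A where "A = 2 / (real n)\<^sup>2 * exp (real n * p\<^sup>2)"
    define B where "B = 4 * real n * exp (real n * p\<^sup>2 * (p\<^sup>2 - 1))"
    have "A > 0" "B > 0" using elim by (simp_all add: A_def B_def)
    have "prob_diam_le_2 n p \<le> (1 + upper_err n) * A * (1 + B)"
    proof (cases "p \<le> cutoff n")
      case True
      \<comment> \<open>The exponentials combine to \<open>exp (n * p^4) \<ge> 1\<close>, so the
        product of the two correction terms is at least the \<open>8 / n\<close> spent on pairs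
        sharing a vertex and disjoint pairs.\<close>
      have "A * B = (2 / (real n)\<^sup>2 * (4 * real n)) *
          (exp (real n * p\<^sup>2) * exp (real n * p\<^sup>2 * (p\<^sup>2 - 1)))"
        unfolding A_def B_def by (simp only: mult_ac)
      also have "2 / (real n)\<^sup>2 * (4 * real n) = 8 / real n"
        using elim by (simp add: field_simps power2_eq_square)
      also have "exp (real n * p\<^sup>2) * exp (real n * p\<^sup>2 * (p\<^sup>2 - 1)) = exp (real n * p\<^sup>2 * p\<^sup>2)"
        by (simp add: exp_add[symmetric] algebra_simps)
      finally have "A * B = 8 / real n * exp (real n * p\<^sup>2 * p\<^sup>2)" .
      moreover have "8 / real n * 1 \<le> 8 / real n * exp (real n * p\<^sup>2 * p\<^sup>2)"
        by (intro mult_left_mono) auto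
      ultimately have AB: "8 / real n \<le> A * B" by simp
      also have "\<dots> \<le> (1 + upper_err n) * (A * B)"
        using err \<open>A > 0\<close> \<open>B > 0\<close> by simp
      finally have AB: "8 / real n \<le> (1 + upper_err n) * (A * B)" .
      have "prob_diam_le_2 n p \<le> (1 + upper_err n) * A + 8 / real n"
        using prob_diam_le_2_le[of p n] second_moment_ratio_le[of p n] below_cutoff[of p n]
          p True elim unfolding A_def by simp
      with AB show ?thesis by (simp add: algebra_simps)
    next
      case False
      have "2 * real n \<le> A"
        using above_cutoff[of n p] False elim by (simp only: A_def not_le)
      then have "1 \<le> A" using elim by simp
      then have "1 * 1 * 1 \<le> (1 + upper_err n) * A * (1 + B)"
        using err \<open>B > 0\<close> by (intro mult_mono) auto
      moreover have "prob_diam_le_2 n p \<le> 1"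
        unfolding prob_diam_le_2_def by simp
      ultimately show ?thesis by simp
    qed
    then show "prob_diam_le_2 n p \<le> (1 + upper_err n) * (2 / (real n)\<^sup>2 * exp (real n * p\<^sup>2))
        * (1 + 4 * real n * exp (real n * p\<^sup>2 * (p\<^sup>2 - 1)))"
      by (simp add: A_def B_def)
  qed
qed

section \<open>Lower bound and the threshold window\<close>

text \<open>In the union bound \<open>1 - p\<close> is estimated by 1 and \<open>1 - p^2\<close> by
  \<open>exp (- p^2)\<close>; having \<open>n - 2\<close> factors instead of \<open>n\<close> costs
  \<open>exp (2 * p^2)\<close>.\<close>

lemma prob_diam_le_2_ge_exp:
  assumes "0 < p" "p < 1" "n \<ge> 2"
  shows "prob_diam_le_2 n p \<ge> 1 - exp (2 * p\<^sup>2) * ((real n)\<^sup>2 / 2) * exp (- (real n * p\<^sup>2))"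
proof -
  have p2: "p\<^sup>2 \<le> 1" using assms by (simp add: power_le_one)
  have "(1 - p) * (1 - p\<^sup>2) ^ (n - 2) \<le> 1 * exp (- (real (n - 2) * p\<^sup>2))"
    using assms p2 by (intro mult_mono one_minus_power_le_exp) auto
  also have "\<dots> = exp (2 * p\<^sup>2) * exp (- (real n * p\<^sup>2))"
    using assms by (simp add: exp_add[symmetric] of_nat_diff algebra_simps)
  finally have "real (n choose 2) * ((1 - p) * (1 - p\<^sup>2) ^ (n - 2))
      \<le> (real n)\<^sup>2 / 2 * (exp (2 * p\<^sup>2) * exp (- (real n * p\<^sup>2)))"
  proof (rule mult_mono[rotated])
    show "real (n choose 2) \<le> (real n)\<^sup>2 / 2"
      by (simp add: real_choose_2 power2_eq_square algebra_simps)
  qed (use assms p2 in auto)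
  then show ?thesis
    using prob_diam_le_2_ge[of p n] assms by (simp add: mult_ac)
qed

text \<open>With \<open>x = n * p^2\<close>, the threshold parameter is the logarithm of the leading
  term in the lower bound, and its negative that of the leading term in the upper bound.\<close>

lemma exp_scaled:
  assumes "n > 0"
  shows "exp (2 * ln (real n) - x - ln 2) = (real n)\<^sup>2 / 2 * exp (- x)"
    and "exp (- (2 * ln (real n) - x - ln 2)) = 2 / (real n)\<^sup>2 * exp x"
  using assms exp_of_nat_mult[of 2 "ln (real n)"]
  by (simp_all add: exp_diff exp_minus exp_add field_simps)

text \<open>At the threshold \<open>t n\<close> is \<open>2 * ln n\<close> up to a bounded term, so
  \<open>t n / sqrt n\<close> vanishes. For \<open>t n = n * p^2\<close> the conclusion says that
  \<open>n * p^4\<close> tends to 0.\<close>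

lemma square_div_tendsto_0_at_threshold:
  fixes t :: "nat \<Rightarrow> real"
  assumes "(\<lambda>n. 2 * ln (real n) - t n - ln 2) \<longlonglongrightarrow> c"
  shows "(\<lambda>n. (t n)\<^sup>2 / real n) \<longlonglongrightarrow> 0"
proof -
  have "(\<lambda>n. (2 * ln (real n) - ln 2) / sqrt (real n)) \<longlonglongrightarrow> 0" by real_asymp
  moreover have "(\<lambda>n. 1 / sqrt (real n)) \<longlonglongrightarrow> 0" by real_asymp
  then have "(\<lambda>n. (2 * ln (real n) - t n - ln 2) * (1 / sqrt (real n))) \<longlonglongrightarrow> c * 0"
    by (intro tendsto_mult assms)
  ultimately have "(\<lambda>n. ((2 * ln (real n) - ln 2) / sqrt (real n)
      - (2 * ln (real n) - t n - ln 2) * (1 / sqrt (real n)))\<^sup>2) \<longlonglongrightarrow> (0 - c * 0)\<^sup>2"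
    by (intro tendsto_power tendsto_diff)
  moreover have "(2 * ln (real n) - ln 2) / sqrt (real n)
      - (2 * ln (real n) - t n - ln 2) * (1 / sqrt (real n)) = t n / sqrt (real n)" for n
    by (simp add: diff_divide_distrib)
  moreover have "(t n / sqrt (real n))\<^sup>2 = (t n)\<^sup>2 / real n" for n
    by (simp add: power_divide)
  ultimately show ?thesis by (simp only: mult_zero_right diff_zero power_zero_numeral)
qed

theorem corollary1p4:
  fixes p :: "nat \<Rightarrow> real"
  assumes p_range: "\<And>n. p n \<in> {0<..<1}"
    and p_lim: "p \<longlonglongrightarrow> 0"
  shows
    "(\<exists>\<epsilon> :: nat \<Rightarrow> real. \<epsilon> \<in> o(\<lambda>_. 1) \<and>
       (\<forall>\<^sub>F n in sequentially. prob_diam_le_2 n (p n)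
          \<ge> 1 - (1 + \<epsilon> n) * ((real n)\<^sup>2 / 2) * exp (- (real n * (p n)\<^sup>2)))) \<and>
     (\<exists>\<epsilon> :: nat \<Rightarrow> real. \<epsilon> \<in> o(\<lambda>_. 1) \<and>
       (\<forall>\<^sub>F n in sequentially. prob_diam_le_2 n (p n)
          \<le> (1 + \<epsilon> n) * (2 / (real n)\<^sup>2 * exp (real n * (p n)\<^sup>2))
              * (1 + 4 * real n * exp (real n * (p n)\<^sup>2 * ((p n)\<^sup>2 - 1))))) \<and>
     (\<forall>c :: real. c \<noteq> 0 \<longrightarrow>
       (\<lambda>n. 2 * ln (real n) - real n * (p n)\<^sup>2 - ln 2) \<longlonglongrightarrow> c \<longrightarrow>
         (c > 0 \<longrightarrow> (\<exists>\<epsilon> :: nat \<Rightarrow> real. \<epsilon> \<in> o(\<lambda>_. 1) \<and>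
            (\<forall>\<^sub>F n in sequentially. prob_diam_le_2 n (p n) \<le> (1 + \<epsilon> n) * exp (- c)))) \<and>
         (c < 0 \<longrightarrow> (\<exists>\<epsilon> :: nat \<Rightarrow> real. \<epsilon> \<in> o(\<lambda>_. 1) \<and>
            (\<forall>\<^sub>F n in sequentially. prob_diam_le_2 n (p n) \<ge> (1 + \<epsilon> n) * (1 - exp c)))))"
proof (intro conjI allI impI)
  have p: "0 < p n" "p n < 1" for n using p_range[of n] by auto
  have lower: "\<forall>\<^sub>F n in sequentially. prob_diam_le_2 n (p n)
      \<ge> 1 - exp (2 * (p n)\<^sup>2) * ((real n)\<^sup>2 / 2) * exp (- (real n * (p n)\<^sup>2))"
    using eventually_ge_at_top[of "2::nat"] by eventually_elim (rule prob_diam_le_2_ge_exp[OF p])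
  have "(\<lambda>n. exp (2 * (p n)\<^sup>2)) \<longlonglongrightarrow> exp (2 * 0\<^sup>2)"
    by (intro tendsto_intros p_lim)
  then have exp_p: "(\<lambda>n. exp (2 * (p n)\<^sup>2)) \<longlonglongrightarrow> 1" by simp
  show "\<exists>\<epsilon>. \<epsilon> \<in> o(\<lambda>_. 1) \<and> (\<forall>\<^sub>F n in sequentially. prob_diam_le_2 n (p n)
      \<ge> 1 - (1 + \<epsilon> n) * ((real n)\<^sup>2 / 2) * exp (- (real n * (p n)\<^sup>2)))"
  proof (intro exI conjI)
    \<comment> \<open>The error is chosen so that \<open>1 + \<epsilon> n\<close> is the factor
      \<open>exp (2 * p^2)\<close> of \<open>lower\<close>.\<close>
    show "(\<lambda>n. exp (2 * (p n)\<^sup>2) - 1) \<in> o(\<lambda>_. 1)"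
      using tendsto_diff[OF exp_p tendsto_const[of 1]] by (intro smallo_1I) simp
  qed (use lower in simp)
  have upper: "\<forall>\<^sub>F n in sequentially. prob_diam_le_2 n (p n)
      \<le> (1 + upper_err n) * (2 / (real n)\<^sup>2 * exp (real n * (p n)\<^sup>2))
        * (1 + 4 * real n * exp (real n * (p n)\<^sup>2 * ((p n)\<^sup>2 - 1)))"
    using eventually_prob_diam_le_2_le by eventually_elim (use p_range in blast)
  then show "\<exists>\<epsilon>. \<epsilon> \<in> o(\<lambda>_. 1) \<and> (\<forall>\<^sub>F n in sequentially. prob_diam_le_2 n (p n)
      \<le> (1 + \<epsilon> n) * (2 / (real n)\<^sup>2 * exp (real n * (p n)\<^sup>2))
        * (1 + 4 * real n * exp (real n * (p n)\<^sup>2 * ((p n)\<^sup>2 - 1))))"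
    using smallo_1I[OF upper_err_tendsto_0] by blast
  fix c :: real
  define \<gamma> where "\<gamma> n = 2 * ln (real n) - real n * (p n)\<^sup>2 - ln 2" for n
  assume "(\<lambda>n. 2 * ln (real n) - real n * (p n)\<^sup>2 - ln 2) \<longlonglongrightarrow> c"
  then have \<gamma>: "\<gamma> \<longlonglongrightarrow> c" unfolding \<gamma>_def .
  have \<gamma>_exp: "exp (\<gamma> n) = (real n)\<^sup>2 / 2 * exp (- (real n * (p n)\<^sup>2))"
    "exp (- \<gamma> n) = 2 / (real n)\<^sup>2 * exp (real n * (p n)\<^sup>2)" if "n > 0" for n
    unfolding \<gamma>_def using that by (simp_all only: exp_scaled)
  show "\<exists>\<epsilon>. \<epsilon> \<in> o(\<lambda>_. 1) \<and>
      (\<forall>\<^sub>F n in sequentially. prob_diam_le_2 n (p n) \<le> (1 + \<epsilon> n) * exp (- c))"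
  proof (intro exI conjI)
    \<comment> \<open>\<open>\<delta>\<close> is the second correction term
      \<open>4 * n * exp (n * p^2 * (p^2 - 1))\<close> with \<open>n^2 / 2 * exp (- n * p^2)\<close>
      replaced by \<open>exp (\<gamma> n)\<close>, so that its limit can be read off.\<close>
    define \<delta> where "\<delta> n = 8 / real n * exp (\<gamma> n) * exp (real n * (p n)\<^sup>2 * (p n)\<^sup>2)" for n
    \<comment> \<open>Solves \<open>(1 + \<epsilon> n) * exp (- c)\<close> = the bound in
      \<open>upper\<close>; since \<open>\<gamma>\<close> tends to \<open>c\<close>, it vanishes in
      the limit.\<close>
    let ?\<epsilon> = "\<lambda>n. (1 + upper_err n) * exp (c - \<gamma> n) * (1 + \<delta> n) - 1"
    have "(\<lambda>n. real n * (p n)\<^sup>2 * (p n)\<^sup>2) \<longlonglongrightarrow> 0"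
    proof (rule Lim_transform_eventually)
      show "(\<lambda>n. (real n * (p n)\<^sup>2)\<^sup>2 / real n) \<longlonglongrightarrow> 0"
        using \<gamma> unfolding \<gamma>_def by (rule square_div_tendsto_0_at_threshold)
      show "\<forall>\<^sub>F n in sequentially. (real n * (p n)\<^sup>2)\<^sup>2 / real n = real n * (p n)\<^sup>2 * (p n)\<^sup>2"
        using eventually_gt_at_top[of "0::nat"] by eventually_elim (simp add: power2_eq_square)
    qed
    moreover have "(\<lambda>n. 8 / real n) \<longlonglongrightarrow> 0" by real_asymp
    ultimately have "\<delta> \<longlonglongrightarrow> 0 * exp c * exp 0"
      unfolding \<delta>_def by (intro tendsto_intros \<gamma>)
    then have "?\<epsilon> \<longlonglongrightarrow> (1 + 0) * exp (c - c) * (1 + 0 * exp c * exp 0) - 1"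
      by (intro tendsto_intros \<gamma> upper_err_tendsto_0)
    then show "?\<epsilon> \<in> o(\<lambda>_. 1)" by (intro smallo_1I) simp
    show "\<forall>\<^sub>F n in sequentially. prob_diam_le_2 n (p n) \<le> (1 + ?\<epsilon> n) * exp (- c)"
      using upper eventually_gt_at_top[of "0::nat"]
    proof eventually_elim
      case (elim n)
      have "exp (real n * (p n)\<^sup>2 * ((p n)\<^sup>2 - 1)) = exp (- (real n * (p n)\<^sup>2)) * exp (real n * (p n)\<^sup>2 * (p n)\<^sup>2)"
        by (simp add: exp_add[symmetric] algebra_simps)
      then have \<delta>_eq: "4 * real n * exp (real n * (p n)\<^sup>2 * ((p n)\<^sup>2 - 1)) = \<delta> n"
        using elim unfolding \<delta>_def \<gamma>_exp(1)[OF elim(2)] by (simp add: power2_eq_square)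
      have exp_eq: "exp (c - \<gamma> n) * exp (- c) = 2 / (real n)\<^sup>2 * exp (real n * (p n)\<^sup>2)"
        unfolding \<gamma>_exp(2)[OF elim(2), symmetric] by (simp add: exp_add[symmetric])
      have "(1 + ?\<epsilon> n) * exp (- c) = (1 + upper_err n) * (exp (c - \<gamma> n) * exp (- c)) * (1 + \<delta> n)"
        by (simp add: mult_ac)
      then show ?case using elim(1) unfolding \<delta>_eq exp_eq by simp
    qed
  qed
  assume "c < 0"
  show "\<exists>\<epsilon>. \<epsilon> \<in> o(\<lambda>_. 1) \<and>
      (\<forall>\<^sub>F n in sequentially. prob_diam_le_2 n (p n) \<ge> (1 + \<epsilon> n) * (1 - exp c))"
  proof (intro exI conjI)
    \<comment> \<open>Solves \<open>(1 + \<epsilon> n) * (1 - exp c)\<close> = the bound in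
      \<open>lower\<close>; \<open>c < 0\<close> makes the divisor positive.\<close>
    let ?\<epsilon> = "\<lambda>n. (1 - exp (2 * (p n)\<^sup>2) * exp (\<gamma> n)) / (1 - exp c) - 1"
    have "1 - exp c > 0" using \<open>c < 0\<close> by simp
    have "?\<epsilon> \<longlonglongrightarrow> (1 - 1 * exp c) / (1 - exp c) - 1"
      using \<open>1 - exp c > 0\<close> by (intro tendsto_intros exp_p \<gamma>) auto
    then show "?\<epsilon> \<in> o(\<lambda>_. 1)" using \<open>1 - exp c > 0\<close> by (intro smallo_1I) simp
    show "\<forall>\<^sub>F n in sequentially. prob_diam_le_2 n (p n) \<ge> (1 + ?\<epsilon> n) * (1 - exp c)"
      using lower eventually_gt_at_top[of "0::nat"]
      by eventually_elim (use \<open>1 - exp c > 0\<close> in \<open>simp add: \<gamma>_exp(1)\<close>)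
  qed
qed

end
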